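(* Let $\Sigma$ be a finite subset of $\mathbb C^*$ and let $z_0\in\mathbb C^*\setminus q^{\mathbb Z}\Sigma$. The natural transformation $$\Gamma_{z_0}:(A^{(0)},M,A^{(\infty)})\mapsto M(z_0)$$ is an element of $\mathrm{Iso}^{\otimes}(\omega^{(0)}_{z_0},\omega^{(\infty)}_{z_0})$, where $\omega^{(0)}_{z_0},\omega^{(\infty)}_{z_0}$ are regarded as fibre functors on $\mathcal C_\Sigma$.
   Context: Fix $q\in\mathbb C$, $|q|>1$; $(\sigma_qF)(z)=F(qz)$. $\mathbb C_\infty$ is the Riemann sphere minus $0$; $\mathcal M(U)$ denotes meromorphic functions on $U$. Category $\mathcal C$: objects are triples $(A^{(0)},M,A^{(\infty)})$ with $A^{(0)},A^{(\infty)}\in GL_n(\mathbb C)$, $M\in GL_n(\mathcal M(\mathbb C^* ))$ and $(\sigma_qM)A^{(0)}=A^{(\infty)}M$. Morphisms $(A^{(0)},M,A^{(\infty)})\to(B^{(0)},N,B^{(\infty)})$ (of ranks $n$, $p$) are pairs $(S^{(0)},S^{(\infty)})$ with $S^{(0)}\in M_{p,n}(\mathcal M(\mathbb C))$, $S^{(\infty)}\in M_{p,n}(\mathcal M(\mathbb C_\infty))$, $(\sigma_qS^{(0)})A^{(0)}=B^{(0)}S^{(0)}$, $(\sigma_qS^{(\infty)})A^{(\infty)}=B^{(\infty)}S^{(\infty)}$ and $S^{(\infty)}M=NS^{(0)}$. (Such $S^{(0)},S^{(\infty)}$ automatically have Laurent polynomial entries.) Tensor products are componentwise Kronecker products. The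 singular locus of $M$ is $\mathcal S(M)=\{\text{poles of }M\}\cup\{\text{poles of }M^{-1}\}$. $\mathcal C_\Sigma$ is the full subcategory of $\mathcal C$ of triples with $\mathcal S(M)\subset q^{\mathbb Z}\Sigma$; it is a tannakian subcategory. For $a\in\mathbb C^*$, $\omega^{(0)}_a$ (resp. $\omega^{(\infty)}_a$) sends $(A^{(0)},M,A^{(\infty)})$ of rank $n$ to $\mathbb C^n$ and $(S^{(0)},S^{(\infty)})$ to $S^{(0)}(a)$ (resp. $S^{(\infty)}(a)$). *)

theory Defs
  imports "HOL-Complex_Analysis.Complex_Analysis" "Jordan_Normal_Form.Matrix"
begin

text \<open>
  Tensor categories and tensor functors in the sense of Deligne and Milne, presented by their data.
  The associativity constraint goes from \<open>X \<otimes> (Y \<otimes> Z)\<close> to \<open>(X \<otimes> Y) \<otimes> Z\<close>, and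
  \<open>comp C g f\<close> is \<open>g\<close> after \<open>f\<close>.
\<close>

record ('o, 'm) tensor_cat =
  objs :: "'o set"
  homs :: "'o \<Rightarrow> 'o \<Rightarrow> 'm set"
  idm :: "'o \<Rightarrow> 'm"
  comp :: "'m \<Rightarrow> 'm \<Rightarrow> 'm"
  tobj :: "'o \<Rightarrow> 'o \<Rightarrow> 'o"
  tmor :: "'m \<Rightarrow> 'm \<Rightarrow> 'm"
  tunit :: "'o"
  assoc_cstr :: "'o \<Rightarrow> 'o \<Rightarrow> 'o \<Rightarrow> 'm"
  braid :: "'o \<Rightarrow> 'o \<Rightarrow> 'm"
  lunit :: "'o \<Rightarrow> 'm"
  runit :: "'o \<Rightarrow> 'm"

text \<open>\<open>ften F X Y : F X \<otimes> F Y \<rightarrow> F (X \<otimes> Y)\<close> and \<open>funit F : 1 \<rightarrow> F 1\<close>.\<close>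

record ('o, 'm, 'p, 'n) tensor_fun =
  fobj :: "'o \<Rightarrow> 'p"
  fmor :: "'m \<Rightarrow> 'n"
  ften :: "'o \<Rightarrow> 'o \<Rightarrow> 'n"
  funit :: "'n"

definition full_subcat :: "('o, 'm) tensor_cat \<Rightarrow> ('o \<Rightarrow> bool) \<Rightarrow> ('o, 'm) tensor_cat" where
  "full_subcat C P = C\<lparr>objs := {X \<in> objs C. P X}\<rparr>"

definition is_isom :: "('o, 'm) tensor_cat \<Rightarrow> 'o \<Rightarrow> 'o \<Rightarrow> 'm \<Rightarrow> bool" where
  "is_isom C X Y f \<longleftrightarrow> f \<in> homs C X Y \<and>
     (\<exists>g \<in> homs C Y X. comp C g f = idm C X \<and> comp C f g = idm C Y)"

definition is_functor ::
  "('o, 'm) tensor_cat \<Rightarrow> ('p, 'n) tensor_cat \<Rightarrow> ('o, 'm, 'p, 'n) tensor_fun \<Rightarrow> bool" where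
  "is_functor C D F \<longleftrightarrow>
     (\<forall>X \<in> objs C. fobj F X \<in> objs D \<and> fmor F (idm C X) = idm D (fobj F X)) \<and>
     (\<forall>X \<in> objs C. \<forall>Y \<in> objs C. \<forall>f \<in> homs C X Y. fmor F f \<in> homs D (fobj F X) (fobj F Y)) \<and>
     (\<forall>X \<in> objs C. \<forall>Y \<in> objs C. \<forall>Z \<in> objs C. \<forall>f \<in> homs C X Y. \<forall>g \<in> homs C Y Z.
        fmor F (comp C g f) = comp D (fmor F g) (fmor F f))"

definition is_tensor_functor ::
  "('o, 'm) tensor_cat \<Rightarrow> ('p, 'n) tensor_cat \<Rightarrow> ('o, 'm, 'p, 'n) tensor_fun \<Rightarrow> bool" where
  "is_tensor_functor C D F \<longleftrightarrow>
     is_functor C D F \<and>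
     is_isom D (tunit D) (fobj F (tunit C)) (funit F) \<and>
     (\<forall>X \<in> objs C. \<forall>Y \<in> objs C.
        is_isom D (tobj D (fobj F X) (fobj F Y)) (fobj F (tobj C X Y)) (ften F X Y)) \<and>
     (\<forall>X \<in> objs C. \<forall>X' \<in> objs C. \<forall>Y \<in> objs C. \<forall>Y' \<in> objs C.
        \<forall>f \<in> homs C X X'. \<forall>g \<in> homs C Y Y'.
        comp D (fmor F (tmor C f g)) (ften F X Y) =
        comp D (ften F X' Y') (tmor D (fmor F f) (fmor F g))) \<and>
     (\<forall>X \<in> objs C. \<forall>Y \<in> objs C. \<forall>Z \<in> objs C.
        comp D (fmor F (assoc_cstr C X Y Z))
          (comp D (ften F X (tobj C Y Z)) (tmor D (idm D (fobj F X)) (ften F Y Z))) =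
        comp D (ften F (tobj C X Y) Z)
          (comp D (tmor D (ften F X Y) (idm D (fobj F Z)))
             (assoc_cstr D (fobj F X) (fobj F Y) (fobj F Z)))) \<and>
     (\<forall>X \<in> objs C. \<forall>Y \<in> objs C.
        comp D (fmor F (braid C X Y)) (ften F X Y) =
        comp D (ften F Y X) (braid D (fobj F X) (fobj F Y))) \<and>
     (\<forall>X \<in> objs C.
        comp D (fmor F (lunit C X))
          (comp D (ften F (tunit C) X) (tmor D (funit F) (idm D (fobj F X)))) =
        lunit D (fobj F X)) \<and>
     (\<forall>X \<in> objs C.
        comp D (fmor F (runit C X))
          (comp D (ften F X (tunit C)) (tmor D (idm D (fobj F X)) (funit F))) =
        runit D (fobj F X))"

definition is_nat_isom ::
  "('o, 'm) tensor_cat \<Rightarrow> ('p, 'n) tensor_cat \<Rightarrow> ('o, 'm, 'p, 'n) tensor_fun \<Rightarrow>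
   ('o, 'm, 'p, 'n) tensor_fun \<Rightarrow> ('o \<Rightarrow> 'n) \<Rightarrow> bool" where
  "is_nat_isom C D F G \<eta> \<longleftrightarrow>
     (\<forall>X \<in> objs C. is_isom D (fobj F X) (fobj G X) (\<eta> X)) \<and>
     (\<forall>X \<in> objs C. \<forall>Y \<in> objs C. \<forall>f \<in> homs C X Y.
        comp D (\<eta> Y) (fmor F f) = comp D (fmor G f) (\<eta> X))"

text \<open>
  Isomorphisms of tensor functors from \<open>F\<close> to \<open>G\<close>; that \<open>F\<close> and \<open>G\<close> are tensor functors is part
  of membership. The values of \<open>\<eta>\<close> outside \<open>objs C\<close> are irrelevant.
\<close>

definition Iso_tensor ::
  "('o, 'm) tensor_cat \<Rightarrow> ('p, 'n) tensor_cat \<Rightarrow> ('o, 'm, 'p, 'n) tensor_fun \<Rightarrow>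
   ('o, 'm, 'p, 'n) tensor_fun \<Rightarrow> ('o \<Rightarrow> 'n) set" where
  "Iso_tensor C D F G = {\<eta>.
     is_tensor_functor C D F \<and> is_tensor_functor C D G \<and> is_nat_isom C D F G \<eta> \<and>
     (\<forall>X \<in> objs C. \<forall>Y \<in> objs C.
        comp D (\<eta> (tobj C X Y)) (ften F X Y) = comp D (ften G X Y) (tmor D (\<eta> X) (\<eta> Y))) \<and>
     comp D (\<eta> (tunit C)) (funit F) = funit G}"

definition kronecker :: "complex mat \<Rightarrow> complex mat \<Rightarrow> complex mat" (infixl "\<otimes>\<^sub>K" 70) where
  "A \<otimes>\<^sub>K B = Matrix.mat (dim_row A * dim_row B) (dim_col A * dim_col B)
     (\<lambda>(i, j). A $$ (i div dim_row B, j div dim_col B) * B $$ (i mod dim_row B, j mod dim_col B))"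

text \<open>
  The matrix of \<open>x \<otimes> y \<mapsto> y \<otimes> x\<close> from \<open>\<complex>\<^sup>n \<otimes> \<complex>\<^sup>p\<close> to \<open>\<complex>\<^sup>p \<otimes> \<complex>\<^sup>n\<close>.
  In both factors the tensor product of basis vectors \<open>i\<close> and \<open>j\<close> is numbered lexicographically,
  as in the Kronecker product.
\<close>

definition swap_mat :: "nat \<Rightarrow> nat \<Rightarrow> complex mat" where
  "swap_mat n p = Matrix.mat (p * n) (n * p)
     (\<lambda>(r, c). if r = (c mod p) * n + c div p then 1 else 0)"

text \<open>
  The target of the fibre functors: the object \<open>n\<close> stands for \<open>\<complex>\<^sup>n\<close>, linear maps
  \<open>\<complex>\<^sup>n \<rightarrow> \<complex>\<^sup>p\<close> are given by their matrices, and \<open>\<complex>\<^sup>n \<otimes> \<complex>\<^sup>p\<close> is identified with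
  \<open>\<complex>\<^sup>n\<^sup>p\<close> through the Kronecker product, which is strictly associative and unital.
\<close>

definition vect_cat :: "(nat, complex mat) tensor_cat" where
  "vect_cat = \<lparr>
     objs = UNIV,
     homs = (\<lambda>n p. carrier_mat p n),
     idm = (\<lambda>n. 1\<^sub>m n),
     comp = (\<lambda>S T. S * T),
     tobj = (\<lambda>n p. n * p),
     tmor = (\<lambda>S T. S \<otimes>\<^sub>K T),
     tunit = 1,
     assoc_cstr = (\<lambda>n p r. 1\<^sub>m (n * (p * r))),
     braid = swap_mat,
     lunit = (\<lambda>n. 1\<^sub>m n),
     runit = (\<lambda>n. 1\<^sub>m n)\<rparr>"

text \<open>
  An element of \<open>\<M>(U)\<close> is represented by its unique representative that is \<open>0\<close> at its poles and
  outside \<open>U\<close>, and continuous at all other points of \<open>U\<close>. Meromorphic functions on the Riemann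
  sphere minus \<open>0\<close> are represented by their restrictions to \<open>\<complex>\<^sup>*\<close>, meromorphy at infinity being
  expressed in the coordinate \<open>1/z\<close>.
\<close>

abbreviation Cstar :: "complex set" where
  "Cstar \<equiv> UNIV - {0}"

definition mero :: "complex set \<Rightarrow> (complex \<Rightarrow> complex) set" where
  "mero U = {f. f nicely_meromorphic_on U \<and> (\<forall>z. z \<notin> U \<longrightarrow> f z = 0)}"

definition mero_inf :: "(complex \<Rightarrow> complex) set" where
  "mero_inf = {f \<in> mero Cstar. (\<lambda>w. f (1 / w)) meromorphic_on {0}}"

definition mats :: "nat \<Rightarrow> nat \<Rightarrow> (complex \<Rightarrow> complex) set \<Rightarrow> (complex \<Rightarrow> complex mat) set" where
  "mats p n K = {F. (\<forall>z. F z \<in> carrier_mat p n) \<and> (\<forall>i<p. \<forall>j<n. (\<lambda>z. F z $$ (i, j)) \<in> K)}"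

text \<open>Equality of matrices of meromorphic functions on \<open>U\<close>, i.e. up to removable singularities.\<close>

definition mero_eq :: "complex set \<Rightarrow> (complex \<Rightarrow> complex mat) \<Rightarrow> (complex \<Rightarrow> complex mat) \<Rightarrow> bool" where
  "mero_eq U F G \<longleftrightarrow> (\<forall>\<^sub>\<approx>z\<in>U. F z = G z)"

text \<open>
  Pointwise products of such representatives are brought back to the form described above by
  \<open>mero_nf\<close>; note that \<open>remove_sings\<close> takes the value \<open>0\<close> at poles.
\<close>

definition mero_nf :: "complex set \<Rightarrow> (complex \<Rightarrow> complex mat) \<Rightarrow> complex \<Rightarrow> complex mat" where
  "mero_nf U F = (\<lambda>z. Matrix.mat (dim_row (F z)) (dim_col (F z))
     (\<lambda>(i, j). if z \<in> U then remove_sings (\<lambda>w. F w $$ (i, j)) z else 0))"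

definition GL :: "nat \<Rightarrow> complex mat set" where
  "GL n = {A \<in> carrier_mat n n. invertible_mat A}"

definition is_mero_inverse :: "nat \<Rightarrow> (complex \<Rightarrow> complex mat) \<Rightarrow> (complex \<Rightarrow> complex mat) \<Rightarrow> bool" where
  "is_mero_inverse n M N \<longleftrightarrow> N \<in> mats n n (mero Cstar) \<and>
     mero_eq Cstar (\<lambda>z. M z * N z) (\<lambda>_. 1\<^sub>m n) \<and> mero_eq Cstar (\<lambda>z. N z * M z) (\<lambda>_. 1\<^sub>m n)"

definition mero_GL :: "nat \<Rightarrow> (complex \<Rightarrow> complex mat) set" where
  "mero_GL n = {M \<in> mats n n (mero Cstar). \<exists>N. is_mero_inverse n M N}"

definition mero_inverse :: "nat \<Rightarrow> (complex \<Rightarrow> complex mat) \<Rightarrow> complex \<Rightarrow> complex mat" where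
  "mero_inverse n M = (THE N. is_mero_inverse n M N)"

definition mat_poles :: "nat \<Rightarrow> (complex \<Rightarrow> complex mat) \<Rightarrow> complex set" where
  "mat_poles n M = {z \<in> Cstar. \<exists>i<n. \<exists>j<n. is_pole (\<lambda>w. M w $$ (i, j)) z}"

definition sing_locus :: "nat \<Rightarrow> (complex \<Rightarrow> complex mat) \<Rightarrow> complex set" where
  "sing_locus n M = mat_poles n M \<union> mat_poles n (mero_inverse n M)"

definition q_orbit :: "complex \<Rightarrow> complex set \<Rightarrow> complex set" where
  "q_orbit q \<Sigma> = {q powi k * s | k s. s \<in> \<Sigma>}"

text \<open>
  Objects are triples \<open>(A\<^sup>(\<^sup>0\<^sup>), M, A\<^sup>(\<^sup>\<infinity>\<^sup>))\<close>, morphisms pairs \<open>(S\<^sup>(\<^sup>0\<^sup>), S\<^sup>(\<^sup>\<infinity>\<^sup>))\<close>.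
\<close>

type_synonym qobj = "complex mat \<times> (complex \<Rightarrow> complex mat) \<times> complex mat"
type_synonym qmor = "(complex \<Rightarrow> complex mat) \<times> (complex \<Rightarrow> complex mat)"

definition rk :: "qobj \<Rightarrow> nat" where
  "rk X = dim_row (fst X)"

definition conn_mat :: "qobj \<Rightarrow> complex \<Rightarrow> complex mat" where
  "conn_mat X = fst (snd X)"

definition q_objs :: "complex \<Rightarrow> qobj set" where
  "q_objs q = {(A0, M, Ai). \<exists>n. A0 \<in> GL n \<and> Ai \<in> GL n \<and> M \<in> mero_GL n \<and>
     mero_eq Cstar (\<lambda>z. M (q * z) * A0) (\<lambda>z. Ai * M z)}"

definition q_homs :: "complex \<Rightarrow> qobj \<Rightarrow> qobj \<Rightarrow> qmor set" where
  "q_homs q X Y = (case X of (A0, M, Ai) \<Rightarrow> case Y of (B0, N, Bi) \<Rightarrow>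
     {(S0, Si). S0 \<in> mats (rk Y) (rk X) (mero UNIV) \<and> Si \<in> mats (rk Y) (rk X) mero_inf \<and>
        mero_eq UNIV (\<lambda>z. S0 (q * z) * A0) (\<lambda>z. B0 * S0 z) \<and>
        mero_eq Cstar (\<lambda>z. Si (q * z) * Ai) (\<lambda>z. Bi * Si z) \<and>
        mero_eq Cstar (\<lambda>z. Si z * M z) (\<lambda>z. N z * S0 z)})"

definition q_const :: "complex mat \<Rightarrow> qmor" where
  "q_const A = (mero_nf UNIV (\<lambda>_. A), mero_nf Cstar (\<lambda>_. A))"

definition q_tobj :: "qobj \<Rightarrow> qobj \<Rightarrow> qobj" where
  "q_tobj = (\<lambda>(A0, M, Ai) (B0, N, Bi).
     (A0 \<otimes>\<^sub>K B0, mero_nf Cstar (\<lambda>z. M z \<otimes>\<^sub>K N z), Ai \<otimes>\<^sub>K Bi))"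

definition q_cat :: "complex \<Rightarrow> (qobj, qmor) tensor_cat" where
  "q_cat q = \<lparr>
     objs = q_objs q,
     homs = q_homs q,
     idm = (\<lambda>X. q_const (1\<^sub>m (rk X))),
     comp = (\<lambda>(S0, Si) (T0, Ti).
       (mero_nf UNIV (\<lambda>z. S0 z * T0 z), mero_nf Cstar (\<lambda>z. Si z * Ti z))),
     tobj = q_tobj,
     tmor = (\<lambda>(S0, Si) (T0, Ti).
       (mero_nf UNIV (\<lambda>z. S0 z \<otimes>\<^sub>K T0 z), mero_nf Cstar (\<lambda>z. Si z \<otimes>\<^sub>K Ti z))),
     tunit = (1\<^sub>m 1, mero_nf Cstar (\<lambda>_. 1\<^sub>m 1), 1\<^sub>m 1),
     assoc_cstr = (\<lambda>X Y Z. q_const (1\<^sub>m (rk X * (rk Y * rk Z)))),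
     braid = (\<lambda>X Y. q_const (swap_mat (rk X) (rk Y))),
     lunit = (\<lambda>X. q_const (1\<^sub>m (rk X))),
     runit = (\<lambda>X. q_const (1\<^sub>m (rk X)))\<rparr>"

definition q_cat_Sigma :: "complex \<Rightarrow> complex set \<Rightarrow> (qobj, qmor) tensor_cat" where
  "q_cat_Sigma q \<Sigma> = full_subcat (q_cat q) (\<lambda>X. sing_locus (rk X) (conn_mat X) \<subseteq> q_orbit q \<Sigma>)"

text \<open>
  Morphisms have Laurent polynomial entries, hence no poles on \<open>\<complex>\<^sup>*\<close>, and the values below are
  genuine values for every \<open>a \<noteq> 0\<close>.
\<close>

definition omega0 :: "complex \<Rightarrow> (qobj, qmor, nat, complex mat) tensor_fun" where
  "omega0 a = \<lparr>
     fobj = rk,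
     fmor = (\<lambda>(S0, Si). S0 a),
     ften = (\<lambda>X Y. 1\<^sub>m (rk X * rk Y)),
     funit = 1\<^sub>m 1\<rparr>"

definition omega_inf :: "complex \<Rightarrow> (qobj, qmor, nat, complex mat) tensor_fun" where
  "omega_inf a = \<lparr>
     fobj = rk,
     fmor = (\<lambda>(S0, Si). Si a),
     ften = (\<lambda>X Y. 1\<^sub>m (rk X * rk Y)),
     funit = 1\<^sub>m 1\<rparr>"

definition Gamma_at :: "complex \<Rightarrow> qobj \<Rightarrow> complex mat" where
  "Gamma_at z0 X = conn_mat X z0"

end

theory Submission
  imports Defs
begin

text \<open>
  Every condition on \<open>\<Gamma>\<close> is an identity between matrices of meromorphic functions, valid up to
  removable singularities and evaluated at the single point \<open>z\<^sub>0\<close>. Such an identity may be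
  evaluated at \<open>z\<^sub>0\<close> whenever all entries are analytic there (\<open>mero_eq_at\<close>); likewise
  the normalised products and Kronecker products of \<open>\<C>\<close> take their pointwise values there
  (\<open>mero_nf_analytic\<close>). So the theorem reduces to the absence of poles at \<open>z\<^sub>0\<close>.

  For \<open>M\<close> and \<open>M\<^sup>-\<^sup>1\<close> this is the hypothesis \<open>z\<^sub>0 \<notin> q\<^sup>\<int>\<Sigma>\<close>. It makes \<open>M(z\<^sub>0)\<close>
  invertible, because \<open>M M\<^sup>-\<^sup>1 = M\<^sup>-\<^sup>1 M = 1\<close> can be evaluated at \<open>z\<^sub>0\<close>
  (\<open>value_off_sing_locus\<close>).

  A morphism has no pole anywhere on \<open>\<complex>\<^sup>*\<close> (\<open>q_homs_analytic\<close>): \<open>S\<^sup>(\<^sup>0\<^sup>)\<close> is meromorphic at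
  \<open>0\<close>, so it has no poles in a punctured disc around \<open>0\<close>, and the equation
  \<open>S\<^sup>(\<^sup>0\<^sup>)(q z) = B\<^sup>(\<^sup>0\<^sup>) S\<^sup>(\<^sup>0\<^sup>)(z) (A\<^sup>(\<^sup>0\<^sup>))\<^sup>-\<^sup>1\<close> enlarges the disc by the factor \<open>\<bar>q\<bar> > 1\<close> as often as
  needed; \<open>S\<^sup>(\<^sup>\<infinity>\<^sup>)\<close> is treated in the same way from infinity. This alone makes both
  evaluations tensor functors (\<open>fibre_functors\<close>). Naturality of \<open>\<Gamma>\<close> is then
  \<open>S\<^sup>(\<^sup>\<infinity>\<^sup>) M = N S\<^sup>(\<^sup>0\<^sup>)\<close> at \<open>z\<^sub>0\<close>, and its compatibility with tensor products is the
  definition of \<open>M \<otimes> N\<close> at \<open>z\<^sub>0\<close>.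
\<close>

section \<open>Matrices with analytic entries\<close>

definition analytic_mat :: "nat \<Rightarrow> nat \<Rightarrow> (complex \<Rightarrow> complex mat) \<Rightarrow> complex \<Rightarrow> bool" where
  "analytic_mat p n F z \<longleftrightarrow>
     (\<forall>w. F w \<in> carrier_mat p n) \<and> (\<forall>i<p. \<forall>j<n. (\<lambda>w. F w $$ (i, j)) analytic_on {z})"

lemma analytic_mat_const: "A \<in> carrier_mat p n \<Longrightarrow> analytic_mat p n (\<lambda>_. A) z"
  by (auto simp: analytic_mat_def)

lemma analytic_mat_mult:
  assumes "analytic_mat p n F z" "analytic_mat n r G z"
  shows "analytic_mat p r (\<lambda>w. F w * G w) z"
proof -
  have F: "F w \<in> carrier_mat p n" and G: "G w \<in> carrier_mat n r" for w
    using assms by (auto simp: analytic_mat_def)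
  have "(\<lambda>w. (F w * G w) $$ (i, j)) analytic_on {z}" if "i < p" "j < r" for i j
  proof -
    have "(\<lambda>w. (F w * G w) $$ (i, j)) = (\<lambda>w. \<Sum>k = 0..<n. F w $$ (i, k) * G w $$ (k, j))"
    proof
      fix w
      show "(F w * G w) $$ (i, j) = (\<Sum>k = 0..<n. F w $$ (i, k) * G w $$ (k, j))"
        using F[of w] G[of w] that by (auto simp: scalar_prod_def intro!: sum.cong)
    qed
    moreover have "(\<lambda>w. \<Sum>k = 0..<n. F w $$ (i, k) * G w $$ (k, j)) analytic_on {z}"
      using assms that by (intro analytic_on_sum analytic_on_mult) (auto simp: analytic_mat_def)
    ultimately show ?thesis by simp
  qed
  with F G show ?thesis
    unfolding analytic_mat_def by (auto intro: mult_carrier_mat)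
qed

lemma kronecker_carrier [simp]:
  "A \<in> carrier_mat p n \<Longrightarrow> B \<in> carrier_mat r s \<Longrightarrow> A \<otimes>\<^sub>K B \<in> carrier_mat (p * r) (n * s)"
  by (auto simp: kronecker_def)

lemma kronecker_one: "1\<^sub>m a \<otimes>\<^sub>K 1\<^sub>m b = 1\<^sub>m (a * b)"
proof (rule eq_matI)
  fix i j assume ij: "i < dim_row (1\<^sub>m (a * b) :: complex mat)" "j < dim_col (1\<^sub>m (a * b) :: complex mat)"
  then have "b > 0" by (cases b) auto
  with ij have "i div b < a" "j div b < a" "i mod b < b" "j mod b < b"
    by (auto simp: less_mult_imp_div_less)
  moreover have "i = j \<longleftrightarrow> i div b = j div b \<and> i mod b = j mod b"
    by (metis div_mult_mod_eq)
  ultimately show "(1\<^sub>m a \<otimes>\<^sub>K 1\<^sub>m b) $$ (i, j) = (1\<^sub>m (a * b) :: complex mat) $$ (i, j)"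
    using ij by (auto simp: kronecker_def)
qed (auto simp: kronecker_def)

lemma analytic_mat_kronecker:
  assumes "analytic_mat p n F z" "analytic_mat r s G z"
  shows "analytic_mat (p * r) (n * s) (\<lambda>w. F w \<otimes>\<^sub>K G w) z"
proof -
  have F: "F w \<in> carrier_mat p n" and G: "G w \<in> carrier_mat r s" for w
    using assms by (auto simp: analytic_mat_def)
  have "(\<lambda>w. (F w \<otimes>\<^sub>K G w) $$ (i, j)) analytic_on {z}" if ij: "i < p * r" "j < n * s" for i j
  proof -
    have eq: "(\<lambda>w. (F w \<otimes>\<^sub>K G w) $$ (i, j))
        = (\<lambda>w. F w $$ (i div r, j div s) * G w $$ (i mod r, j mod s))"
      using ij by (simp add: kronecker_def carrier_matD[OF F] carrier_matD[OF G])
    have "r > 0" "s > 0" using ij by (auto intro: gr0I)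
    then show ?thesis
      unfolding eq using assms ij
      by (intro analytic_on_mult) (auto simp: analytic_mat_def less_mult_imp_div_less)
  qed
  with F G show ?thesis
    unfolding analytic_mat_def by auto
qed

lemma mero_nf_analytic:
  assumes "analytic_mat p n F z" "z \<in> U"
  shows "mero_nf U F z = F z"
proof (rule eq_matI)
  have F: "F w \<in> carrier_mat p n" for w using assms by (auto simp: analytic_mat_def)
  fix i j assume "i < dim_row (F z)" "j < dim_col (F z)"
  then show "mero_nf U F z $$ (i, j) = F z $$ (i, j)"
    using assms carrier_matD[OF F, of z] by (auto simp: mero_nf_def analytic_mat_def)
qed (auto simp: mero_nf_def)

lemma q_const_eval:
  "fst (q_const A) z = A" "z \<noteq> 0 \<Longrightarrow> snd (q_const A) z = A"
  using mero_nf_analytic[OF analytic_mat_const[of A "dim_row A" "dim_col A"]]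
  by (auto simp: q_const_def)

text \<open>An identity off a single point extends to it: both sides are continuous there, and
  limits along the punctured neighbourhood are unique.\<close>

lemma analytic_mat_eq_at:
  assumes "analytic_mat p n F z" "analytic_mat p n G z" "eventually (\<lambda>w. F w = G w) (at z)"
  shows "F z = G z"
proof (rule eq_matI)
  have F: "F w \<in> carrier_mat p n" and G: "G w \<in> carrier_mat p n" for w
    using assms by (auto simp: analytic_mat_def)
  fix i j assume "i < dim_row (G z)" "j < dim_col (G z)"
  then have ij: "i < p" "j < n" using G[of z] by auto
  have 1: "((\<lambda>w. F w $$ (i, j)) \<longlongrightarrow> F z $$ (i, j)) (at z)"
    using assms(1) ij analytic_at_imp_isCont isContD unfolding analytic_mat_def by blast
  have "((\<lambda>w. G w $$ (i, j)) \<longlongrightarrow> G z $$ (i, j)) (at z)"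
    using assms(2) ij analytic_at_imp_isCont isContD unfolding analytic_mat_def by blast
  then have 2: "((\<lambda>w. F w $$ (i, j)) \<longlongrightarrow> G z $$ (i, j)) (at z)"
    by (rule Lim_transform_eventually) (use assms(3) in \<open>auto elim!: eventually_mono\<close>)
  show "F z $$ (i, j) = G z $$ (i, j)"
    using tendsto_unique[OF _ 1 2] by simp
qed (use assms in \<open>auto simp: analytic_mat_def dest!: spec[of _ z]\<close>)

lemma mero_eqD: "mero_eq U F G \<Longrightarrow> z \<in> U \<Longrightarrow> eventually (\<lambda>w. F w = G w) (at z)"
  unfolding mero_eq_def by (rule eventually_cosparse_imp_eventually_at)

lemma mero_eq_at:
  assumes "mero_eq U F G" "z \<in> U" "analytic_mat p n F z" "analytic_mat p n G z"
  shows "F z = G z"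
  using analytic_mat_eq_at[OF assms(3,4) mero_eqD[OF assms(1,2)]] .

section \<open>Meromorphic matrices and their inverses\<close>

text \<open>The chosen value at a point is \<open>0\<close> at a pole and the limit elsewhere, so it is
  determined by the germ on the punctured neighbourhood.\<close>

lemma nicely_meromorphic_eq_at:
  assumes "f nicely_meromorphic_on U" "g nicely_meromorphic_on U" "z \<in> U"
    and "eventually (\<lambda>w. f w = g w) (at z)"
  shows "f z = g z"
proof -
  have val: "remove_sings h z = h z" if "h nicely_meromorphic_on U" for h
    using that assms(3) remove_sings_eqI[of h "h z" z] remove_sings_at_pole[of h z]
    unfolding nicely_meromorphic_on_def by metis
  show ?thesis
    using remove_sings_cong[OF assms(4) refl] val[OF assms(1)] val[OF assms(2)] by simp
qed

text \<open>Needed because \<open>mero_inverse\<close> is a definite description. The usual argument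
  \<open>N = N (M N') = (N M) N' = N'\<close> holds pointwise off a sparse set; the normalisation at the
  remaining points and at \<open>0\<close> turns this into equality of functions.\<close>

lemma is_mero_inverse_unique:
  assumes M: "M \<in> mats n n K" and N: "is_mero_inverse n M N" and N': "is_mero_inverse n M N'"
  shows "N = N'"
proof (rule ext, rule eq_matI)
  fix z i j
  have c: "M w \<in> carrier_mat n n" "N w \<in> carrier_mat n n" "N' w \<in> carrier_mat n n" for w
    using assms by (auto simp: is_mero_inverse_def mats_def)
  show "dim_row (N z) = dim_row (N' z)" "dim_col (N z) = dim_col (N' z)"
    using c[of z] by auto
  assume "i < dim_row (N' z)" "j < dim_col (N' z)"
  then have ij: "i < n" "j < n" using c[of z] by auto
  have m: "(\<lambda>z. N z $$ (i, j)) \<in> mero Cstar" "(\<lambda>z. N' z $$ (i, j)) \<in> mero Cstar"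
    using assms ij by (auto simp: is_mero_inverse_def mats_def)
  show "N z $$ (i, j) = N' z $$ (i, j)"
  proof (cases "z = 0")
    case True
    then show ?thesis using m by (auto simp: mero_def)
  next
    case False
    have "eventually (\<lambda>w. N w * M w = 1\<^sub>m n) (at z)" "eventually (\<lambda>w. M w * N' w = 1\<^sub>m n) (at z)"
      using N N' False mero_eqD[of Cstar _ _ z] by (auto simp: is_mero_inverse_def)
    then have "eventually (\<lambda>w. N w $$ (i, j) = N' w $$ (i, j)) (at z)"
    proof eventually_elim
      case (elim w)
      have "N w = N w * (M w * N' w)" using elim c[of w] by simp
      also have "\<dots> = (N w * M w) * N' w"
        using c[of w] by (simp add: assoc_mult_mat[of _ n n _ n _ n])
      also have "\<dots> = N' w" using elim c[of w] by simp
      finally show ?case by simp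
    qed
    with m False show ?thesis
      by (intro nicely_meromorphic_eq_at[of _ Cstar]) (auto simp: mero_def)
  qed
qed

lemma mero_inverse:
  assumes "M \<in> mero_GL n"
  shows "is_mero_inverse n M (mero_inverse n M)"
proof -
  obtain N where N: "is_mero_inverse n M N" and M: "M \<in> mats n n (mero Cstar)"
    using assms by (auto simp: mero_GL_def)
  show ?thesis
    unfolding mero_inverse_def
    by (rule theI[of _ N]) (use N is_mero_inverse_unique[OF M] in auto)
qed

lemma analytic_mat_off_poles:
  assumes "M \<in> mats n n (mero Cstar)" "z \<noteq> 0" "z \<notin> mat_poles n M"
  shows "analytic_mat n n M z"
  using assms unfolding analytic_mat_def mats_def mat_poles_def mero_def
  by (auto intro!: nicely_meromorphic_on_imp_analytic_at[of _ Cstar])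

text \<open>Off the singular locus \<open>M\<close> and \<open>M\<^sup>-\<^sup>1\<close> are both analytic, so the two inverse identities
  hold at the point itself.\<close>

lemma value_off_sing_locus:
  assumes M: "M \<in> mero_GL n" and z: "z \<noteq> 0" "z \<notin> sing_locus n M"
  shows "analytic_mat n n M z"
    and "\<exists>N \<in> carrier_mat n n. M z * N = 1\<^sub>m n \<and> N * M z = 1\<^sub>m n"
proof -
  let ?N = "mero_inverse n M"
  have inv: "is_mero_inverse n M ?N" using M by (rule mero_inverse)
  show aM: "analytic_mat n n M z"
    using M z by (intro analytic_mat_off_poles) (auto simp: mero_GL_def sing_locus_def)
  have aN: "analytic_mat n n ?N z"
    using inv z by (intro analytic_mat_off_poles) (auto simp: is_mero_inverse_def sing_locus_def)
  have "M z * ?N z = 1\<^sub>m n" "?N z * M z = 1\<^sub>m n"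
    using inv z mero_eq_at[OF _ _ analytic_mat_mult[OF aM aN] analytic_mat_const[of "1\<^sub>m n"]]
      mero_eq_at[OF _ _ analytic_mat_mult[OF aN aM] analytic_mat_const[of "1\<^sub>m n"]]
    by (auto simp: is_mero_inverse_def)
  moreover have "?N z \<in> carrier_mat n n" using aN by (simp add: analytic_mat_def)
  ultimately show "\<exists>N \<in> carrier_mat n n. M z * N = 1\<^sub>m n \<and> N * M z = 1\<^sub>m n" by blast
qed

section \<open>Morphisms have no poles on the punctured plane\<close>

lemma filtermap_at_times:
  fixes c z :: complex
  assumes "c \<noteq> 0"
  shows "filtermap ((*) c) (at z) = at (c * z)"
  by (rule filtermap_nhds_eq_imp_filtermap_at_eq) (use assms filtermap_nhds_times in auto)

text \<open>Agreement with an analytic function near \<open>c z\<close> gives a finite limit there, hence no pole;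
  a nice representative without a pole is analytic.\<close>

lemma analytic_at_transport:
  fixes c z :: complex
  assumes f: "f nicely_meromorphic_on U" "c * z \<in> U" and h: "h analytic_on {z}" and c: "c \<noteq> 0"
    and ev: "eventually (\<lambda>w. f (c * w) = h w) (at z)"
  shows "f analytic_on {c * z}"
proof -
  have "(h \<longlongrightarrow> h z) (at z)" using h analytic_at_imp_isCont isContD by blast
  then have "((\<lambda>w. f (c * w)) \<longlongrightarrow> h z) (at z)"
    by (rule Lim_transform_eventually) (use ev in \<open>auto elim!: eventually_mono\<close>)
  then have "(f \<longlongrightarrow> h z) (filtermap ((*) c) (at z))"
    by (simp add: filterlim_filtermap)
  then have "(f \<longlongrightarrow> h z) (at (c * z))" using c by (simp add: filtermap_at_times)
  then have "\<not> is_pole f (c * z)"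
    unfolding is_pole_def using not_tendsto_and_filterlim_at_infinity trivial_limit_at by blast
  with f show ?thesis by (intro nicely_meromorphic_on_imp_analytic_at)
qed

text \<open>Both \<open>q\<close>-difference equations of a morphism express \<open>F (c w)\<close> through \<open>F w\<close>, with
  \<open>c = q\<close> at \<open>0\<close> and \<open>c = 1 / q\<close> at infinity.\<close>

lemma analytic_mat_transport:
  assumes F: "F \<in> mats p n K" "\<And>f. f \<in> K \<Longrightarrow> f nicely_meromorphic_on U"
    and AB: "A \<in> carrier_mat n n" "B \<in> carrier_mat p p" and c: "c \<noteq> 0" and cz: "c * z \<in> U"
    and ev: "eventually (\<lambda>w. F (c * w) = B * F w * A) (at z)" and z: "analytic_mat p n F z"
  shows "analytic_mat p n F (c * z)"
proof -
  have an: "analytic_mat p n (\<lambda>w. B * F w * A) z"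
    using AB z by (intro analytic_mat_mult[of p n] analytic_mat_mult[of p p] analytic_mat_const)
  have "(\<lambda>w. F w $$ (i, j)) analytic_on {c * z}" if ij: "i < p" "j < n" for i j
  proof (rule analytic_at_transport[of _ U c z])
    show "(\<lambda>w. F w $$ (i, j)) nicely_meromorphic_on U"
      using F ij by (auto simp: mats_def)
    show "(\<lambda>w. (B * F w * A) $$ (i, j)) analytic_on {z}"
      using an ij unfolding analytic_mat_def by blast
    show "eventually (\<lambda>w. F (c * w) $$ (i, j) = (B * F w * A) $$ (i, j)) (at z)"
      using ev by eventually_elim simp
  qed (use c cz in auto)
  with F show ?thesis by (auto simp: analytic_mat_def mats_def)
qed

lemma analytic_mat_transport_power:
  assumes "F \<in> mats p n K" "\<And>f. f \<in> K \<Longrightarrow> f nicely_meromorphic_on U"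
    and "A \<in> carrier_mat n n" "B \<in> carrier_mat p p" and c: "c \<noteq> 0" and U: "Cstar \<subseteq> U"
    and "\<And>z. z \<noteq> 0 \<Longrightarrow> eventually (\<lambda>w. F (c * w) = B * F w * A) (at z)"
    and z: "z \<noteq> 0" "analytic_mat p n F z"
  shows "analytic_mat p n F (c ^ k * z)"
proof (induction k)
  case (Suc k)
  have "c * (c ^ k * z) \<in> U" using c z U by auto
  then have "analytic_mat p n F (c * (c ^ k * z))"
    using assms Suc by (intro analytic_mat_transport[of F p n K U A B c "c ^ k * z"]) auto
  then show ?case by (simp add: mult.assoc)
qed (use z in simp)

lemma power_inverse_at_0:
  fixes q a :: complex
  assumes "norm q > 1" "a \<noteq> 0"
  shows "filterlim (\<lambda>k. inverse q ^ k * a) (at 0) sequentially"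
proof -
  have "norm (inverse q) < 1" using assms by (simp add: norm_inverse inverse_less_1_iff)
  then have "(\<lambda>k. inverse q ^ k * a) \<longlonglongrightarrow> 0 * a"
    by (intro tendsto_intros LIMSEQ_power_zero)
  moreover have "inverse q ^ k * a \<noteq> 0" for k using assms by auto
  ultimately show ?thesis by (auto simp: filterlim_at)
qed

lemma meromorphic_eventually_analytic:
  "f meromorphic_on {z} \<Longrightarrow> eventually (\<lambda>w. f analytic_on {w}) (at z)"
  using eventually_cosparse_imp_eventually_at[OF meromorphic_on_imp_analytic_cosparse] by blast

lemma GL_inverse:
  assumes "A \<in> GL n"
  obtains B where "B \<in> carrier_mat n n" "A * B = 1\<^sub>m n" "B * A = 1\<^sub>m n"
proof -
  from assms obtain B where A: "A \<in> carrier_mat n n" and B: "inverts_mat A B" "inverts_mat B A"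
    by (auto simp: GL_def invertible_mat_def)
  then have "A * B = 1\<^sub>m n" "B * A = 1\<^sub>m (dim_row B)" by (auto simp: inverts_mat_def)
  moreover from this have "dim_col B = n" "dim_row B = n"
    using A by (metis carrier_matD(2) index_mult_mat(3) index_one_mat(3))+
  ultimately show ?thesis using that[of B] by auto
qed

text \<open>A meromorphic matrix has no pole in a small punctured disc around \<open>0\<close>, and the equation
  \<open>F (q w) = B F(w) A\<^sup>-\<^sup>1\<close> spreads this over all of \<open>\<complex>\<^sup>*\<close>, since the orbit
  \<open>z / q\<^sup>k\<close> of any point enters the disc.\<close>

lemma analytic_mat_at_0_side:
  assumes q: "norm q > 1" and F: "F \<in> mats p n (mero UNIV)" and A: "A \<in> GL n" and B: "B \<in> GL p"
    and eq: "mero_eq UNIV (\<lambda>z. F (q * z) * A) (\<lambda>z. B * F z)" and z: "z \<noteq> 0"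
  shows "analytic_mat p n F z"
proof -
  obtain A' where A': "A' \<in> carrier_mat n n" "A * A' = 1\<^sub>m n" using A by (rule GL_inverse)
  have cA: "A \<in> carrier_mat n n" and cB: "B \<in> carrier_mat p p" using A B by (auto simp: GL_def)
  have cF: "F w \<in> carrier_mat p n" for w using F by (auto simp: mats_def)
  have q0: "q \<noteq> 0" using q by auto
  have ev: "eventually (\<lambda>w. F (q * w) = B * F w * A') (at z)" for z
    using mero_eqD[OF eq UNIV_I]
  proof eventually_elim
    case (elim w)
    have "F (q * w) = F (q * w) * (A * A')" using cF[of "q * w"] A' by simp
    also have "\<dots> = B * F w * A'"
      using cF[of "q * w"] A'(1) cA elim by (simp add: assoc_mult_mat[of _ p n _ n _ n, symmetric])
    finally show ?case .
  qed
  have "eventually (\<lambda>w. \<forall>i\<in>{..<p}. \<forall>j\<in>{..<n}. (\<lambda>w. F w $$ (i, j)) analytic_on {w}) (at 0)"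
    using F by (intro eventually_ball_finite ballI meromorphic_eventually_analytic)
      (auto simp: mats_def mero_def nicely_meromorphic_on_def intro: meromorphic_on_subset)
  then have "eventually (\<lambda>w. analytic_mat p n F w) (at 0)"
    by eventually_elim (use cF in \<open>auto simp: analytic_mat_def\<close>)
  then have "eventually (\<lambda>k. analytic_mat p n F (inverse q ^ k * z)) sequentially"
    using power_inverse_at_0[OF q z] unfolding filterlim_iff by blast
  then obtain k where k: "analytic_mat p n F (inverse q ^ k * z)"
    by (auto dest: eventually_happens)
  have "analytic_mat p n F (q ^ k * (inverse q ^ k * z))"
    by (rule analytic_mat_transport_power[OF F, of UNIV A' B])
      (use ev A' cB q0 z k in \<open>auto simp: mero_def\<close>)
  moreover have "q ^ k * (inverse q ^ k * z) = z"
    using q0 by (simp add: field_simps)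
  ultimately show ?thesis by simp
qed

text \<open>The same argument, started at infinity and run with \<open>q\<close> replaced by \<open>1 / q\<close>.\<close>

lemma analytic_mat_at_infinity_side:
  assumes q: "norm q > 1" and F: "F \<in> mats p n mero_inf" and A: "A \<in> GL n" and B: "B \<in> GL p"
    and eq: "mero_eq Cstar (\<lambda>z. F (q * z) * A) (\<lambda>z. B * F z)" and z: "z \<noteq> 0"
  shows "analytic_mat p n F z"
proof -
  obtain B' where B': "B' \<in> carrier_mat p p" "B' * B = 1\<^sub>m p" using B by (rule GL_inverse)
  have cA: "A \<in> carrier_mat n n" and cB: "B \<in> carrier_mat p p" using A B by (auto simp: GL_def)
  have cF: "F w \<in> carrier_mat p n" for w using F by (auto simp: mats_def)
  have q0: "q \<noteq> 0" using q by auto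
  have ev: "eventually (\<lambda>w. F (inverse q * w) = B' * F w * A) (at z)" if "z \<noteq> 0" for z
  proof -
    have "eventually (\<lambda>u. F (q * u) * A = B * F u) (at (inverse q * z))"
      using that q0 by (intro mero_eqD[OF eq]) auto
    then have "eventually (\<lambda>w. F (q * (inverse q * w)) * A = B * F (inverse q * w)) (at z)"
      using q0 by (subst (asm) filtermap_at_times[symmetric]) (auto simp: eventually_filtermap)
    then show ?thesis
    proof eventually_elim
      case (elim w)
      then have *: "F w * A = B * F (inverse q * w)"
        using q0 by (simp add: mult.assoc[symmetric])
      have "F (inverse q * w) = (B' * B) * F (inverse q * w)" using cF[of "inverse q * w"] B' by simp
      also have "\<dots> = B' * (F w * A)"
        using cF[of "inverse q * w"] B'(1) cB * by (simp add: assoc_mult_mat[of _ p p _ p _ n])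
      also have "\<dots> = B' * F w * A"
        using cF[of w] B'(1) cA by (simp add: assoc_mult_mat[of _ p p _ n _ n])
      finally show ?case .
    qed
  qed
  have fin: "eventually (\<lambda>w. (\<lambda>w. F w $$ (i, j)) analytic_on {inverse w}) (at 0)"
    if ij: "i < p" "j < n" for i j
  proof -
    \<comment> \<open>Meromorphy at infinity is given in the coordinate \<open>1 / w\<close>; composing with the inversion
      recovers the entry, also at \<open>0\<close> since \<open>1 / 0 = 0\<close>.\<close>
    let ?g = "\<lambda>w. F (1 / w) $$ (i, j)"
    have "?g meromorphic_on {0}" using F ij by (auto simp: mats_def mero_inf_def)
    from meromorphic_eventually_analytic[OF this] have "eventually (\<lambda>w. ?g analytic_on {w}) (at 0)" .
    moreover have "eventually (\<lambda>w::complex. w \<noteq> 0) (at 0)" by (simp add: eventually_at_filter)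
    ultimately show ?thesis
    proof eventually_elim
      case (elim w)
      have "(?g \<circ> inverse) analytic_on {inverse w}"
        using elim by (intro analytic_on_compose analytic_intros) auto
      then show ?case by (simp add: o_def divide_inverse)
    qed
  qed
  have "eventually (\<lambda>w. \<forall>i\<in>{..<p}. \<forall>j\<in>{..<n}. (\<lambda>w. F w $$ (i, j)) analytic_on {inverse w}) (at 0)"
    using fin by (intro eventually_ball_finite ballI) auto
  then have "eventually (\<lambda>w. analytic_mat p n F (inverse w)) (at 0)"
    by eventually_elim (use cF in \<open>auto simp: analytic_mat_def\<close>)
  then have "eventually (\<lambda>k. analytic_mat p n F (inverse (inverse q ^ k * inverse z))) sequentially"
    using power_inverse_at_0[OF q, of "inverse z"] z unfolding filterlim_iff by fastforce
  \<comment> \<open>This point is \<open>q\<^sup>k z\<close>.\<close>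
  then obtain k where k: "analytic_mat p n F (inverse (inverse q ^ k * inverse z))"
    by (auto dest: eventually_happens)
  have "analytic_mat p n F (inverse q ^ k * inverse (inverse q ^ k * inverse z))"
    by (rule analytic_mat_transport_power[OF F, of Cstar A B'])
      (use ev cA B' q0 z k in \<open>auto simp: mero_def mero_inf_def\<close>)
  moreover have "inverse q ^ k * inverse (inverse q ^ k * inverse z) = z"
    using q0 z by (simp add: field_simps)
  ultimately show ?thesis by (simp only:)
qed

lemma q_objsE:
  assumes "X \<in> q_objs q"
  obtains A0 M Ai where "X = (A0, M, Ai)" "A0 \<in> GL (rk X)" "Ai \<in> GL (rk X)" "M \<in> mero_GL (rk X)"
  using assms by (auto simp: q_objs_def rk_def GL_def)

lemma q_homs_analytic:
  assumes q: "norm q > 1" and X: "X \<in> q_objs q" and Y: "Y \<in> q_objs q"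
    and f: "f \<in> q_homs q X Y" and z: "z \<noteq> 0"
  shows "analytic_mat (rk Y) (rk X) (fst f) z" "analytic_mat (rk Y) (rk X) (snd f) z"
proof -
  obtain A0 M Ai where X': "X = (A0, M, Ai)" "A0 \<in> GL (rk X)" "Ai \<in> GL (rk X)"
    using X by (rule q_objsE)
  obtain B0 N Bi where Y': "Y = (B0, N, Bi)" "B0 \<in> GL (rk Y)" "Bi \<in> GL (rk Y)"
    using Y by (rule q_objsE)
  from f have S: "fst f \<in> mats (rk Y) (rk X) (mero UNIV)" "snd f \<in> mats (rk Y) (rk X) mero_inf"
    "mero_eq UNIV (\<lambda>z. fst f (q * z) * A0) (\<lambda>z. B0 * fst f z)"
    "mero_eq Cstar (\<lambda>z. snd f (q * z) * Ai) (\<lambda>z. Bi * snd f z)"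
    unfolding q_homs_def X'(1) Y'(1) by auto
  show "analytic_mat (rk Y) (rk X) (fst f) z"
    by (rule analytic_mat_at_0_side[OF q S(1) X'(2) Y'(2) S(3) z])
  show "analytic_mat (rk Y) (rk X) (snd f) z"
    by (rule analytic_mat_at_infinity_side[OF q S(2) X'(3) Y'(3) S(4) z])
qed

section \<open>Evaluation as a fibre functor\<close>

lemma vect_isom_one: "a = n \<Longrightarrow> b = n \<Longrightarrow> is_isom vect_cat a b (1\<^sub>m n)"
  by (auto simp: is_isom_def vect_cat_def intro!: bexI[of _ "1\<^sub>m n"])

lemma rk_tobj: "rk (q_tobj X Y) = rk X * rk Y"
  by (cases X; cases Y) (auto simp: q_tobj_def rk_def kronecker_def)

lemma swap_mat_carrier: "swap_mat n p \<in> carrier_mat (p * n) (n * p)"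
  by (auto simp: swap_mat_def)

text \<open>The constraints of the first category are constant, with the constraints of the
  second as their values, so an evaluation is a
  tensor functor as soon as it is compatible with composition, Kronecker products and constants.\<close>

lemma evaluation_tensor_functor:
  fixes ev :: "qmor \<Rightarrow> complex mat"
  assumes const: "\<And>A. ev (q_const A) = A"
    and mor: "\<And>X Y f. X \<in> q_objs q \<Longrightarrow> Y \<in> q_objs q \<Longrightarrow> f \<in> q_homs q X Y \<Longrightarrow>
      ev f \<in> carrier_mat (rk Y) (rk X)"
    and cmp: "\<And>X Y Z f g. X \<in> q_objs q \<Longrightarrow> Y \<in> q_objs q \<Longrightarrow> Z \<in> q_objs q \<Longrightarrow>
      f \<in> q_homs q X Y \<Longrightarrow> g \<in> q_homs q Y Z \<Longrightarrow> ev (comp (q_cat q) g f) = ev g * ev f"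
    and ten: "\<And>X X' Y Y' f g. X \<in> q_objs q \<Longrightarrow> X' \<in> q_objs q \<Longrightarrow> Y \<in> q_objs q \<Longrightarrow>
      Y' \<in> q_objs q \<Longrightarrow> f \<in> q_homs q X X' \<Longrightarrow> g \<in> q_homs q Y Y' \<Longrightarrow>
      ev (tmor (q_cat q) f g) = ev f \<otimes>\<^sub>K ev g"
  shows "is_tensor_functor (full_subcat (q_cat q) P) vect_cat
    \<lparr>fobj = rk, fmor = ev, ften = (\<lambda>X Y. 1\<^sub>m (rk X * rk Y)), funit = 1\<^sub>m 1\<rparr>"
proof -
  let ?C = "full_subcat (q_cat q) P"
  let ?F = "\<lparr>fobj = rk, fmor = ev, ften = (\<lambda>X Y. 1\<^sub>m (rk X * rk Y)), funit = 1\<^sub>m 1\<rparr>"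
  have C: "objs ?C \<subseteq> q_objs q" "homs ?C = q_homs q" "comp ?C = comp (q_cat q)"
    "tmor ?C = tmor (q_cat q)" "idm ?C = (\<lambda>X. q_const (1\<^sub>m (rk X)))" "tobj ?C = q_tobj"
    "rk (tunit ?C) = 1" "assoc_cstr ?C = (\<lambda>X Y Z. q_const (1\<^sub>m (rk X * (rk Y * rk Z))))"
    "braid ?C = (\<lambda>X Y. q_const (swap_mat (rk X) (rk Y)))"
    "lunit ?C = (\<lambda>X. q_const (1\<^sub>m (rk X)))" "runit ?C = (\<lambda>X. q_const (1\<^sub>m (rk X)))"
    by (auto simp: full_subcat_def q_cat_def rk_def)
  have D: "objs vect_cat = UNIV" "homs vect_cat = (\<lambda>n p. carrier_mat p n)"
    "idm vect_cat = (\<lambda>n. 1\<^sub>m n)" "comp vect_cat = (\<lambda>S T. S * T)" "tobj vect_cat = (\<lambda>n p. n * p)"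
    "tmor vect_cat = (\<lambda>S T. S \<otimes>\<^sub>K T)" "tunit vect_cat = 1"
    "assoc_cstr vect_cat = (\<lambda>n p r. 1\<^sub>m (n * (p * r)))" "braid vect_cat = swap_mat"
    "lunit vect_cat = (\<lambda>n. 1\<^sub>m n)" "runit vect_cat = (\<lambda>n. 1\<^sub>m n)"
    by (simp_all add: vect_cat_def)
  have fctr: "is_functor ?C vect_cat ?F"
    unfolding is_functor_def
  proof (intro conjI ballI)
    fix X Y Z f g
    assume "X \<in> objs ?C" "Y \<in> objs ?C" "Z \<in> objs ?C" "f \<in> homs ?C X Y" "g \<in> homs ?C Y Z"
    then show "fmor ?F (comp ?C g f) = comp vect_cat (fmor ?F g) (fmor ?F f)"
      using cmp[OF C(1)[THEN subsetD] C(1)[THEN subsetD] C(1)[THEN subsetD], of X Y Z f g]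
      by (simp add: C(2-) D)
  next
    fix X Y f
    assume "X \<in> objs ?C" "Y \<in> objs ?C" "f \<in> homs ?C X Y"
    then show "fmor ?F f \<in> homs vect_cat (fobj ?F X) (fobj ?F Y)"
      using mor[OF C(1)[THEN subsetD] C(1)[THEN subsetD], of X Y f] by (simp add: C(2-) D)
  qed (simp_all add: C(2-) D const)
  have nat: "ev (tmor (q_cat q) f g) * 1\<^sub>m (rk X * rk Y) = 1\<^sub>m (rk X' * rk Y') * (ev f \<otimes>\<^sub>K ev g)"
    if "X \<in> objs ?C" "X' \<in> objs ?C" "Y \<in> objs ?C" "Y' \<in> objs ?C"
      "f \<in> q_homs q X X'" "g \<in> q_homs q Y Y'" for X X' Y Y' f g
  proof -
    have o: "X \<in> q_objs q" "X' \<in> q_objs q" "Y \<in> q_objs q" "Y' \<in> q_objs q"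
      using that C(1) by auto
    have "ev f \<otimes>\<^sub>K ev g \<in> carrier_mat (rk X' * rk Y') (rk X * rk Y)"
      using mor[OF o(1,2) that(5)] mor[OF o(3,4) that(6)] by simp
    then show ?thesis using ten[OF o that(5,6)] by simp
  qed
  have braid: "swap_mat n p * 1\<^sub>m (n * p) = 1\<^sub>m (p * n) * swap_mat n p" for n p
    using swap_mat_carrier[of n p] by simp
  show ?thesis
    unfolding is_tensor_functor_def
    using fctr by (auto simp: C(2-) D const rk_tobj kronecker_one braid mult.assoc
        intro!: vect_isom_one[unfolded One_nat_def] nat)
qed

lemma fibre_functors:
  assumes q: "norm q > 1" and a: "a \<noteq> 0"
  shows "is_tensor_functor (full_subcat (q_cat q) P) vect_cat (omega0 a)"
    and "is_tensor_functor (full_subcat (q_cat q) P) vect_cat (omega_inf a)"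
proof -
  note an = q_homs_analytic[OF q _ _ _ a]
  have ops: "comp (q_cat q) g f =
      (mero_nf UNIV (\<lambda>z. fst g z * fst f z), mero_nf Cstar (\<lambda>z. snd g z * snd f z))"
    "tmor (q_cat q) g f =
      (mero_nf UNIV (\<lambda>z. fst g z \<otimes>\<^sub>K fst f z), mero_nf Cstar (\<lambda>z. snd g z \<otimes>\<^sub>K snd f z))" for f g
    by (auto simp: q_cat_def split: prod.splits)
  have w: "omega0 a =
    \<lparr>fobj = rk, fmor = (\<lambda>f. fst f a), ften = (\<lambda>X Y. 1\<^sub>m (rk X * rk Y)), funit = 1\<^sub>m 1\<rparr>"
    "omega_inf a =
    \<lparr>fobj = rk, fmor = (\<lambda>f. snd f a), ften = (\<lambda>X Y. 1\<^sub>m (rk X * rk Y)), funit = 1\<^sub>m 1\<rparr>"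
    by (auto simp: omega0_def omega_inf_def case_prod_unfold)
  show "is_tensor_functor (full_subcat (q_cat q) P) vect_cat (omega0 a)"
    unfolding w
  proof (rule evaluation_tensor_functor, goal_cases)
    case (2 X Y f)
    then show ?case using an(1)[of X Y f] by (simp add: analytic_mat_def)
  next
    case (3 X Y Z f g)
    then show ?case
      using mero_nf_analytic[OF analytic_mat_mult[OF an(1)[of Y Z g] an(1)[of X Y f]], of UNIV]
      by (simp add: ops)
  next
    case (4 X X' Y Y' f g)
    then show ?case
      using mero_nf_analytic[OF analytic_mat_kronecker[OF an(1)[of X X' f] an(1)[of Y Y' g]], of UNIV]
      by (simp add: ops)
  qed (simp add: q_const_eval)
  show "is_tensor_functor (full_subcat (q_cat q) P) vect_cat (omega_inf a)"
    unfolding w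
  proof (rule evaluation_tensor_functor, goal_cases)
    case (2 X Y f)
    then show ?case using an(2)[of X Y f] by (simp add: analytic_mat_def)
  next
    case (3 X Y Z f g)
    then show ?case
      using mero_nf_analytic[OF analytic_mat_mult[OF an(2)[of Y Z g] an(2)[of X Y f]], of Cstar] a
      by (simp add: ops)
  next
    case (4 X X' Y Y' f g)
    then show ?case
      using mero_nf_analytic[OF analytic_mat_kronecker[OF an(2)[of X X' f] an(2)[of Y Y' g]], of Cstar] a
      by (simp add: ops)
  qed (simp add: q_const_eval a)
qed

section \<open>The connection matrix as an isomorphism of fibre functors\<close>

lemma Gamma_at_natural:
  assumes q: "norm q > 1" and z: "z \<noteq> 0" and X: "X \<in> q_objs q" and Y: "Y \<in> q_objs q"
    and aX: "analytic_mat (rk X) (rk X) (conn_mat X) z"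
    and aY: "analytic_mat (rk Y) (rk Y) (conn_mat Y) z"
    and f: "f \<in> q_homs q X Y"
  shows "Gamma_at z Y * fst f z = snd f z * Gamma_at z X"
proof -
  have "mero_eq Cstar (\<lambda>z. snd f z * conn_mat X z) (\<lambda>z. conn_mat Y z * fst f z)"
    using f by (auto simp: q_homs_def conn_mat_def split: prod.splits)
  then have "snd f z * conn_mat X z = conn_mat Y z * fst f z"
    by (rule mero_eq_at)
      (use z in simp, (rule analytic_mat_mult q_homs_analytic[OF q X Y f z] aX aY)+)
  then show ?thesis by (simp add: Gamma_at_def)
qed

lemma Gamma_at_tensor:
  assumes "z \<noteq> 0" "analytic_mat n n (conn_mat X) z" "analytic_mat p p (conn_mat Y) z"
  shows "Gamma_at z (q_tobj X Y) = Gamma_at z X \<otimes>\<^sub>K Gamma_at z Y"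
  using mero_nf_analytic[OF analytic_mat_kronecker[OF assms(2,3)], of Cstar] assms(1)
  by (cases X; cases Y) (simp add: Gamma_at_def conn_mat_def q_tobj_def)

theorem mainTheorem5:
  fixes q z0 :: complex and \<Sigma> :: "complex set"
  assumes "norm q > 1"
    and "finite \<Sigma>"
    and "\<Sigma> \<subseteq> UNIV - {0}"
    and "z0 \<in> (UNIV - {0}) - q_orbit q \<Sigma>"
  shows "Gamma_at z0 \<in> Iso_tensor (q_cat_Sigma q \<Sigma>) vect_cat (omega0 z0) (omega_inf z0)"
proof -
  let ?C = "q_cat_Sigma q \<Sigma>"
  have z: "z0 \<noteq> 0" using assms(4) by auto
  have C: "homs ?C = q_homs q" "tobj ?C = q_tobj"
    "tunit ?C = (1\<^sub>m 1, mero_nf Cstar (\<lambda>_. 1\<^sub>m 1), 1\<^sub>m 1)"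
    by (auto simp: q_cat_Sigma_def full_subcat_def q_cat_def)
  have obj: "X \<in> q_objs q" "sing_locus (rk X) (conn_mat X) \<subseteq> q_orbit q \<Sigma>"
    if "X \<in> objs ?C" for X
    using that by (auto simp: q_cat_Sigma_def full_subcat_def q_cat_def)
  have GL: "conn_mat X \<in> mero_GL (rk X)" if "X \<in> q_objs q" for X
    using that by (rule q_objsE) (simp add: conn_mat_def)
  have an: "analytic_mat (rk X) (rk X) (conn_mat X) z0" if "X \<in> objs ?C" for X
    using value_off_sing_locus(1)[OF GL z] obj[OF that] assms(4) by blast
  have car: "Gamma_at z0 X \<in> carrier_mat (rk X) (rk X)" if "X \<in> objs ?C" for X
    using an[OF that] by (simp add: Gamma_at_def analytic_mat_def)
  have iso: "is_isom vect_cat (rk X) (rk X) (Gamma_at z0 X)" if X: "X \<in> objs ?C" for X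
  proof -
    have "\<exists>N \<in> carrier_mat (rk X) (rk X). conn_mat X z0 * N = 1\<^sub>m (rk X) \<and> N * conn_mat X z0 = 1\<^sub>m (rk X)"
      using value_off_sing_locus(2)[OF GL z] obj[OF X] assms(4) by blast
    then show ?thesis
      using car[OF X] by (auto simp: is_isom_def vect_cat_def Gamma_at_def)
  qed
  have nat: "is_nat_isom ?C vect_cat (omega0 z0) (omega_inf z0) (Gamma_at z0)"
    unfolding is_nat_isom_def
  proof (intro conjI ballI)
    fix X Y f assume X: "X \<in> objs ?C" and Y: "Y \<in> objs ?C" and f: "f \<in> homs ?C X Y"
    have "Gamma_at z0 Y * fst f z0 = snd f z0 * Gamma_at z0 X"
      by (rule Gamma_at_natural[OF assms(1) z obj(1)[OF X] obj(1)[OF Y] an[OF X] an[OF Y]])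
        (use f in \<open>simp add: C\<close>)
    then show "comp vect_cat (Gamma_at z0 Y) (fmor (omega0 z0) f) =
        comp vect_cat (fmor (omega_inf z0) f) (Gamma_at z0 X)"
      by (simp add: vect_cat_def omega0_def omega_inf_def case_prod_unfold)
  qed (use iso in \<open>simp add: omega0_def omega_inf_def\<close>)
  have ten: "comp vect_cat (Gamma_at z0 (tobj ?C X Y)) (ften (omega0 z0) X Y) =
      comp vect_cat (ften (omega_inf z0) X Y) (tmor vect_cat (Gamma_at z0 X) (Gamma_at z0 Y))"
    if X: "X \<in> objs ?C" and Y: "Y \<in> objs ?C" for X Y
    using Gamma_at_tensor[OF z an[OF X] an[OF Y]] kronecker_carrier[OF car[OF X] car[OF Y]]
    by (simp add: C vect_cat_def omega0_def omega_inf_def)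
  have "Gamma_at z0 (tunit ?C) = 1\<^sub>m 1"
    using mero_nf_analytic[OF analytic_mat_const[of "1\<^sub>m 1" 1 1], of z0 Cstar] z
    by (simp add: C Gamma_at_def conn_mat_def)
  then have unit: "comp vect_cat (Gamma_at z0 (tunit ?C)) (funit (omega0 z0)) = funit (omega_inf z0)"
    by (simp add: vect_cat_def omega0_def omega_inf_def)
  show ?thesis
    unfolding Iso_tensor_def
    using fibre_functors[OF assms(1) z] nat ten unit by (simp add: q_cat_Sigma_def)
qed

end
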